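(* Define finite $0$-$1$ blocks by $B_0=0$ and $B_{k+1}=B_kB_k1B_k$ for $k\ge 0$ (so $B_1=0010$), and let $X$ be the set of all $x\in\{0,1\}^{\mathbb Z}$ such that for all $i<j$ in $\mathbb Z$ the word $x_{[i,j]}$ is a subword of $B_k$ for some $k\in\mathbb N$. Let $\sigma$ be the shift on $\{0,1\}^{\mathbb Z}$ restricted to $X$ (the symbolic Chacón transformation). Then the flow $(X,\sigma)$ (that is, the action of $\mathbb Z$ on $X$ generated by $\sigma$) satisfies $SP(X)=\Delta$; that is, $(X,\sigma)$ is weakly distal.
   Context: The shift is $(\sigma x)_n=x_{n+1}$, and $x_{[i,j]}=x_ix_{i+1}\cdots x_j$. A flow $(X,T)$ is a jointly continuous left action of a topological group $T$ on a compact Hausdorff (in particular, compact metric) space $X$; here $T=\mathbb Z$. $T$ acts diagonally on $X\times X$, and $\Delta\subset X\times X$ is the diagonal. A point is almost periodic if its orbit closure is a minimal set (non-empty, closed, $T$-invariant, minimal with these properties). $\Omega(X)$ is the set of all almost periodic points of $(X\times X,T)$. The strongly proximal relation is $SP(X)=\{(x,y)\in X\times X:\overline{T(x,y)}\cap\Omega(X)\subset\Delta\}$. The flow is weakly distal if $SP(X)=\Delta$. *)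

theory Defs
  imports "HOL-Analysis.Analysis" "HOL-Library.Sublist"
begin

text \<open>
  The library makes a function space Hausdorff only via its metric, which requires a metric
  codomain; the topological separation axioms hold for products in general.
\<close>

lemma open_coordinate_preimage:
  fixes U :: "'b::topological_space set"
  assumes "open U"
  shows "open {z :: 'a \<Rightarrow> 'b. z i \<in> U}"
  using open_vimage[OF assms continuous_on_product_coordinates]
  unfolding vimage_def .

instance "fun" :: (type, t0_space) t0_space
proof
  fix x y :: "'a \<Rightarrow> 'b" assume "x \<noteq> y"
  then obtain i where "x i \<noteq> y i" by blast
  from t0_space_class.t0_space[OF this] obtain U where U: "open U" "\<not> (x i \<in> U \<longleftrightarrow> y i \<in> U)"
    by blast
  then have "\<not> (x \<in> {z. z i \<in> U} \<longleftrightarrow> y \<in> {z. z i \<in> U})"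
    by simp
  with open_coordinate_preimage[OF U(1)] show "\<exists>U. open U \<and> \<not> (x \<in> U \<longleftrightarrow> y \<in> U)"
    by (intro exI conjI)
qed

instance "fun" :: (type, t1_space) t1_space
proof
  fix x y :: "'a \<Rightarrow> 'b" assume "x \<noteq> y"
  then obtain i where "x i \<noteq> y i" by blast
  from t1_space_class.t1_space[OF this] obtain U where U: "open U" "x i \<in> U" "y i \<notin> U"
    by blast
  then have "x \<in> {z. z i \<in> U}" "y \<notin> {z. z i \<in> U}"
    by simp_all
  with open_coordinate_preimage[OF U(1)] show "\<exists>U. open U \<and> x \<in> U \<and> y \<notin> U"
    by (intro exI conjI)
qed

instance "fun" :: (type, t2_space) t2_space
proof
  fix x y :: "'a \<Rightarrow> 'b" assume "x \<noteq> y"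
  then obtain i where "x i \<noteq> y i" by blast
  from hausdorff[OF this] obtain U V where
    UV: "open U" "open V" "x i \<in> U" "y i \<in> V" "U \<inter> V = {}"
    by blast
  then have "x \<in> {z. z i \<in> U}" "y \<in> {z. z i \<in> V}"
    "{z. z i \<in> U} \<inter> {z. z i \<in> V} = {}"
    by auto
  with open_coordinate_preimage[OF UV(1)] open_coordinate_preimage[OF UV(2)]
  show "\<exists>U V. open U \<and> open V \<and> x \<in> U \<and> y \<in> V \<and> U \<inter> V = {}"
    by (intro exI conjI)
qed

text \<open>
  The phase space is a set \<open>X\<close> in an ambient Hausdorff space, carrying the subspace topology; an
  action is a curried function \<open>act\<close>, used only on \<open>X\<close>.  If \<open>X\<close> is compact, it is closed in the
  ambient space, so closures of subsets of \<open>X\<close> may be taken there.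
\<close>

definition flow :: "(int \<Rightarrow> 'a \<Rightarrow> 'a) \<Rightarrow> 'a::t2_space set \<Rightarrow> bool" where
  "flow act X \<longleftrightarrow>
     compact X \<and>
     (\<forall>t. \<forall>x\<in>X. act t x \<in> X) \<and>
     (\<forall>x\<in>X. act 0 x = x) \<and>
     (\<forall>s t. \<forall>x\<in>X. act (s + t) x = act s (act t x)) \<and>
     continuous_on (UNIV \<times> X) (\<lambda>(t, x). act t x)"

definition orbit_closure :: "(int \<Rightarrow> 'a \<Rightarrow> 'a) \<Rightarrow> 'a::t2_space \<Rightarrow> 'a set" where
  "orbit_closure act x = closure (range (\<lambda>t. act t x))"

definition nonempty_closed_invariant :: "(int \<Rightarrow> 'a \<Rightarrow> 'a) \<Rightarrow> 'a::t2_space set \<Rightarrow> bool" where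
  "nonempty_closed_invariant act M \<longleftrightarrow> M \<noteq> {} \<and> closed M \<and> (\<forall>t. \<forall>x\<in>M. act t x \<in> M)"

definition minimal_set :: "(int \<Rightarrow> 'a \<Rightarrow> 'a) \<Rightarrow> 'a::t2_space set \<Rightarrow> 'a set \<Rightarrow> bool" where
  "minimal_set act X M \<longleftrightarrow>
     M \<subseteq> X \<and> nonempty_closed_invariant act M \<and>
     (\<forall>N. N \<subseteq> M \<and> nonempty_closed_invariant act N \<longrightarrow> N = M)"

definition almost_periodic :: "(int \<Rightarrow> 'a \<Rightarrow> 'a) \<Rightarrow> 'a::t2_space set \<Rightarrow> 'a \<Rightarrow> bool" where
  "almost_periodic act X x \<longleftrightarrow> x \<in> X \<and> minimal_set act X (orbit_closure act x)"

definition diag_act :: "(int \<Rightarrow> 'a \<Rightarrow> 'a) \<Rightarrow> int \<Rightarrow> 'a \<times> 'a \<Rightarrow> 'a \<times> 'a" where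
  "diag_act act t = map_prod (act t) (act t)"

definition Omega :: "(int \<Rightarrow> 'a \<Rightarrow> 'a) \<Rightarrow> 'a::t2_space set \<Rightarrow> ('a \<times> 'a) set" where
  "Omega act X = {p. almost_periodic (diag_act act) (X \<times> X) p}"

definition SP :: "(int \<Rightarrow> 'a \<Rightarrow> 'a) \<Rightarrow> 'a::t2_space set \<Rightarrow> ('a \<times> 'a) set" where
  "SP act X =
     {p \<in> X \<times> X. orbit_closure (diag_act act) p \<inter> Omega act X \<subseteq> Id_on X}"

definition weakly_distal :: "(int \<Rightarrow> 'a \<Rightarrow> 'a) \<Rightarrow> 'a::t2_space set \<Rightarrow> bool" where
  "weakly_distal act X \<longleftrightarrow> flow act X \<and> SP act X = Id_on X"

definition int_action :: "('a \<Rightarrow> 'a) \<Rightarrow> int \<Rightarrow> 'a \<Rightarrow> 'a" where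
  "int_action f t = (if 0 \<le> t then f ^^ nat t else inv f ^^ nat (- t))"

text \<open>
  Bi-infinite sequences are functions of type \<open>int \<Rightarrow> nat\<close>; this type carries the product of the
  discrete topologies, which induces the usual topology on \<open>{0, 1}\<close>-valued sequences.
\<close>

definition shift :: "(int \<Rightarrow> 'a) \<Rightarrow> int \<Rightarrow> 'a" where
  "shift x n = x (n + 1)"

definition word :: "(int \<Rightarrow> 'a) \<Rightarrow> int \<Rightarrow> int \<Rightarrow> 'a list" where
  "word x i j = map x [i..j]"

fun chacon_block :: "nat \<Rightarrow> nat list" where
  "chacon_block 0 = [0]"
| "chacon_block (Suc k) = chacon_block k @ chacon_block k @ [1] @ chacon_block k"

definition chacon_space :: "(int \<Rightarrow> nat) set" where
  "chacon_space =
     {x. (\<forall>n. x n \<in> {0, 1}) \<and> (\<forall>i j. i < j \<longrightarrow> (\<exists>k. sublist (word x i j) (chacon_block k)))}"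

definition chacon_action :: "int \<Rightarrow> (int \<Rightarrow> nat) \<Rightarrow> int \<Rightarrow> nat" where
  "chacon_action = int_action shift"

lemma int_action_shift: "int_action shift t x = (\<lambda>n. x (n + t))"
proof -
  have inv: "inv shift = (\<lambda>x n. x (n - 1) :: 'a)"
    by (rule inv_equality) (auto simp: shift_def)
  have pos: "(shift ^^ m) x = (\<lambda>n. x (n + int m))" for m
    by (induction m) (auto simp: shift_def algebra_simps fun_eq_iff)
  have neg: "(inv shift ^^ m) x = (\<lambda>n. x (n - int m))" for m
    by (induction m) (auto simp: inv algebra_simps fun_eq_iff)
  show ?thesis
    by (auto simp: int_action_def pos neg)
qed

lemma compact_binary_sequences: "compact {x :: int \<Rightarrow> nat. \<forall>n. x n \<in> {0, 1}}"
proof -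
  have "compactin (product_topology (\<lambda>_. euclidean) (UNIV :: int set))
          (PiE (UNIV :: int set) (\<lambda>_. {0, 1 :: nat}))"
    by (subst compactin_PiE) (auto intro: finite_imp_compact)
  moreover have "PiE (UNIV :: int set) (\<lambda>_. {0, 1 :: nat}) = {x. \<forall>n. x n \<in> {0, 1}}"
    by (auto simp: PiE_def Pi_def)
  ultimately show ?thesis
    by (simp add: euclidean_product_topology)
qed

lemma compact_chacon_space: "compact chacon_space"
proof -
  have closed_word: "closed {x :: int \<Rightarrow> nat. word x i j \<in> S}" for i j S
  proof -
    have "open {x :: int \<Rightarrow> nat. word x i j \<in> T}" for T
    proof (rule Topological_Spaces.openI)
      fix x :: "int \<Rightarrow> nat" assume "x \<in> {x. word x i j \<in> T}"
      then have x: "word x i j \<in> T" by simp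
      let ?U = "\<Inter>n\<in>{i..j}. {y :: int \<Rightarrow> nat. y n = x n}"
      have "open {y :: int \<Rightarrow> nat. y n = x n}" for n
        using open_coordinate_preimage[of "{x n}" n] by (simp add: open_discrete)
      then have "open ?U"
        by (intro open_INT) auto
      moreover have "x \<in> ?U"
        by simp
      moreover have "?U \<subseteq> {x. word x i j \<in> T}"
      proof
        fix y assume "y \<in> ?U"
        then have "word y i j = word x i j"
          by (auto simp: word_def)
        with x show "y \<in> {x. word x i j \<in> T}" by simp
      qed
      ultimately show "\<exists>V. open V \<and> x \<in> V \<and> V \<subseteq> {x. word x i j \<in> T}"
        by blast
    qed
    from this[of "- S"] have "open (- {x :: int \<Rightarrow> nat. word x i j \<in> S})"
      by (simp add: Collect_neg_eq)
    then show ?thesis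
      by (simp add: closed_def)
  qed
  let ?L = "{w. \<exists>k. sublist w (chacon_block k)}"
  have "closed (\<Inter>i. \<Inter>j\<in>{i<..}. {x. word x i j \<in> ?L})"
    by (rule closed_INT, rule ballI, rule closed_INT, rule ballI, rule closed_word)
  with compact_binary_sequences
  have "compact ({x. \<forall>n. x n \<in> {0, 1}} \<inter> (\<Inter>i. \<Inter>j\<in>{i<..}. {x. word x i j \<in> ?L}))"
    by (rule compact_Int_closed)
  also have "{x. \<forall>n. x n \<in> {0, 1}} \<inter> (\<Inter>i. \<Inter>j\<in>{i<..}. {x. word x i j \<in> ?L}) = chacon_space"
    by (rule set_eqI, simp add: chacon_space_def, simp add: Ball_def)
  finally show ?thesis .
qed

lemma chacon_flow: "flow chacon_action chacon_space"
  unfolding flow_def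
proof (intro conjI allI ballI)
  fix t x assume x: "x \<in> chacon_space"
  have "word (\<lambda>n. x (n + t)) i j = word x (i + t) (j + t)" for i j
    by (rule nth_equalityI) (auto simp: word_def algebra_simps)
  with x show "chacon_action t x \<in> chacon_space"
    by (simp add: chacon_space_def chacon_action_def int_action_shift)
next
  have "continuous_on (UNIV \<times> UNIV :: (int \<times> (int \<Rightarrow> nat)) set) (\<lambda>(t, x). chacon_action t x)"
    unfolding continuous_on_def
  proof (safe)
    fix t :: int and x :: "int \<Rightarrow> nat"
    have "open ({t} \<times> (UNIV :: (int \<Rightarrow> nat) set))"
      by (simp add: open_Times open_discrete)
    then have "\<forall>\<^sub>F p in at (t, x). p \<in> {t} \<times> UNIV"
      by (rule eventually_at_in_open') simp
    then have ev: "\<forall>\<^sub>F p in at (t, x).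
        chacon_action t (snd p) = (case p of (s, y) \<Rightarrow> chacon_action s y)"
      by (rule eventually_mono) auto
    have "continuous_on UNIV (\<lambda>p :: int \<times> (int \<Rightarrow> nat). chacon_action t (snd p))"
      unfolding chacon_action_def int_action_shift
      by (rule continuous_on_coordinatewise_then_product,
          rule continuous_on_compose2[OF continuous_on_product_coordinates
            continuous_on_snd[OF continuous_on_id]])
        simp
    then have "((\<lambda>p. chacon_action t (snd p)) \<longlongrightarrow> chacon_action t x) (at (t, x))"
      unfolding continuous_on_def by (metis UNIV_I snd_conv)
    with ev show "((\<lambda>(s, y). chacon_action s y) \<longlongrightarrow> chacon_action t x)
        (at (t, x) within UNIV \<times> UNIV)"
      by (simp add: tendsto_cong)
  qed
  then show "continuous_on (UNIV \<times> chacon_space) (\<lambda>(t, x). chacon_action t x)"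
    by (rule continuous_on_subset) auto
next
  fix s t x
  show "chacon_action (s + t) x = chacon_action s (chacon_action t x)"
    by (simp add: chacon_action_def int_action_shift add.assoc)
qed (simp_all add: compact_chacon_space chacon_action_def int_action_shift)

end

theory Submission
  imports Defs
begin

text \<open>
  Suppose \<open>(x, y)\<close> is strongly proximal and \<open>x \<noteq> y\<close>.  The orbit closure \<open>C\<close> of \<open>(x, y)\<close> contains an
  almost periodic point, which has to be of the form \<open>(z, z)\<close>; hence for every \<open>k\<close> some copy of \<open>B\<^sub>k\<close>
  sits at the same place in \<open>x\<close> and in \<open>y\<close>.  Walk from there, block by block, towards a coordinate
  where \<open>x\<close> and \<open>y\<close> differ.  The walk must meet a gap which is empty in one sequence and a spacer in
  the other, and right behind that gap \<open>x\<close> and \<open>y\<close> show \<open>B\<^sub>k\<close> at places that differ by exactly one.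
  As \<open>k\<close> is arbitrary, by compactness \<open>C\<close> contains a pair \<open>(u, v)\<close> where \<open>v\<close> is \<open>u\<close> shifted by one
  step left or right.  Such pairs form a closed invariant set off the diagonal, so \<open>C\<close> has an almost
  periodic point off the diagonal, a contradiction.
\<close>

section \<open>Almost periodic points\<close>

lemma flow_continuous_on_act:
  assumes "flow act X"
  shows "continuous_on X (act t)"
proof -
  have "continuous_on (UNIV \<times> X) (\<lambda>(t, x). act t x)"
    using assms by (simp add: flow_def)
  then have "continuous_on X (\<lambda>x. (\<lambda>(t, x). act t x) (t, x))"
    by (rule continuous_on_compose2) (auto intro!: continuous_intros)
  then show ?thesis by simp
qed

lemma flow_diag_act:
  assumes "flow act X"
  shows "flow (diag_act act) (X \<times> X)"
proof -
  have c: "continuous_on (UNIV \<times> X) (\<lambda>(t, x). act t x)"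
    using assms by (simp add: flow_def)
  have "continuous_on (UNIV \<times> (X \<times> X)) (\<lambda>q. (\<lambda>(t, x). act t x) (fst q, fst (snd q)))"
    by (rule continuous_on_compose2[OF c]) (auto intro!: continuous_intros)
  moreover have "continuous_on (UNIV \<times> (X \<times> X)) (\<lambda>q. (\<lambda>(t, x). act t x) (fst q, snd (snd q)))"
    by (rule continuous_on_compose2[OF c]) (auto intro!: continuous_intros)
  ultimately have "continuous_on (UNIV \<times> (X \<times> X))
      (\<lambda>q. ((\<lambda>(t, x). act t x) (fst q, fst (snd q)), (\<lambda>(t, x). act t x) (fst q, snd (snd q))))"
    by (rule continuous_on_Pair)
  moreover have "(\<lambda>q. ((\<lambda>(t, x). act t x) (fst q, fst (snd q)),
      (\<lambda>(t, x). act t x) (fst q, snd (snd q)))) = (\<lambda>(t, p). diag_act act t p)"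
    by (auto simp: diag_act_def fun_eq_iff)
  ultimately have "continuous_on (UNIV \<times> (X \<times> X)) (\<lambda>(t, p). diag_act act t p)"
    by (simp only:)
  with assms show ?thesis
    unfolding flow_def by (simp add: compact_Times) (auto simp: diag_act_def)
qed

lemma mem_orbit_closure:
  assumes "flow act X" "x \<in> X"
  shows "x \<in> orbit_closure act x"
proof -
  have "act 0 x = x"
    using assms by (simp add: flow_def)
  then have "x \<in> range (\<lambda>t. act t x)"
    by (metis rangeI)
  then show ?thesis
    unfolding orbit_closure_def by (rule subsetD[OF closure_subset])
qed

lemma orbit_closure_subset:
  assumes "nonempty_closed_invariant act M" "x \<in> M"
  shows "orbit_closure act x \<subseteq> M"
  unfolding orbit_closure_def
  using assms by (intro closure_minimal) (auto simp: nonempty_closed_invariant_def)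

lemma orbit_closure_subset_space:
  assumes "flow act X" "x \<in> X"
  shows "orbit_closure act x \<subseteq> X"
proof (rule orbit_closure_subset)
  show "nonempty_closed_invariant act X"
    using assms by (auto simp: nonempty_closed_invariant_def flow_def compact_imp_closed)
qed fact

lemma nonempty_closed_invariant_orbit_closure:
  assumes "flow act X" "x \<in> X"
  shows "nonempty_closed_invariant act (orbit_closure act x)"
  unfolding nonempty_closed_invariant_def
proof (intro conjI allI)
  show "orbit_closure act x \<noteq> {}"
    using mem_orbit_closure[OF assms] by blast
  show cl: "closed (orbit_closure act x)"
    by (simp add: orbit_closure_def)
  fix t
  have "act t (act s x) = act (t + s) x" for s
    using assms by (simp add: flow_def)
  then have "act t ` range (\<lambda>s. act s x) \<subseteq> range (\<lambda>s. act s x)"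
    by auto
  also have "\<dots> \<subseteq> orbit_closure act x"
    by (simp add: orbit_closure_def closure_subset)
  finally have orb: "act t ` range (\<lambda>s. act s x) \<subseteq> orbit_closure act x" .
  have "continuous_on (orbit_closure act x) (act t)"
    using flow_continuous_on_act[OF assms(1)] orbit_closure_subset_space[OF assms]
    by (rule continuous_on_subset)
  then have "act t ` closure (range (\<lambda>s. act s x)) \<subseteq> orbit_closure act x"
    using cl orb unfolding orbit_closure_def by (rule image_closure_subset)
  then show "\<forall>y\<in>orbit_closure act x. act t y \<in> orbit_closure act x"
    by (auto simp: orbit_closure_def)
qed

text \<open>Zorn's lemma is applied to complements, so that the union of a chain stands for an
  intersection of closed invariant sets. A non-empty finite part of the chain has a largest member,
  whose complement is non-empty; compactness of \<open>C\<close> extends this to the whole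
  chain.\<close>

lemma minimal_set_exists:
  assumes "compact X" "C \<subseteq> X" "nonempty_closed_invariant act C"
  obtains M where "M \<subseteq> C" "minimal_set act X M"
proof -
  let ?A = "{U. - U \<subseteq> C \<and> nonempty_closed_invariant act (- U)}"
  have "- C \<in> ?A"
    using assms by simp
  then have "\<exists>M\<in>?A. \<forall>U\<in>?A. M \<subseteq> U \<longrightarrow> U = M"
  proof (intro subset_Zorn_nonempty)
    fix \<U> assume ne: "\<U> \<noteq> {}" and chain: "subset.chain ?A \<U>"
    have A: "\<U> \<subseteq> ?A"
      using chain by (simp add: subset.chain_def)
    have lin: "U \<subseteq> V \<or> V \<subseteq> U" if "U \<in> \<U>" "V \<in> \<U>" for U V
      using chain that unfolding subset_chain_def by blast
    have "C \<inter> \<Inter>(uminus ` \<U>) \<noteq> {}"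
    proof (rule compact_imp_fip)
      have "closed C"
        using assms by (simp add: nonempty_closed_invariant_def)
      then show "compact C"
        using assms closed_Int_compact[of C X] by (simp add: Int_absorb2)
      show "closed T" if "T \<in> uminus ` \<U>" for T
        using that A by (auto simp: nonempty_closed_invariant_def)
      fix F' assume F': "finite F'" "F' \<subseteq> uminus ` \<U>"
      then obtain F where F: "finite F" "F \<subseteq> \<U>" "F' = uminus ` F"
        by (meson finite_subset_image)
      show "C \<inter> \<Inter>F' \<noteq> {}"
      proof (cases "F = {}")
        case True
        then show ?thesis using F assms by (simp add: nonempty_closed_invariant_def)
      next
        case False
        have "subset.chain UNIV F"
          unfolding subset_chain_def
        proof (intro conjI subset_UNIV ballI)
          fix U V assume "U \<in> F" "V \<in> F"
          then show "U \<subseteq> V \<or> V \<subseteq> U"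
            using F(2) by (intro lin) auto
        qed
        then have "\<Union>F \<in> F"
          by (rule Union_in_chain[OF F(1) False])
        then have "\<Union>F \<in> ?A"
          by (rule subsetD[OF subset_trans[OF F(2) A]])
        then have "- \<Union>F \<noteq> {}" "- \<Union>F \<subseteq> C"
          by (auto simp: nonempty_closed_invariant_def)
        then show ?thesis
          unfolding F(3) by auto
      qed
    qed
    then have "- \<Union>\<U> \<noteq> {}"
      by auto
    moreover have "closed (- \<Union>\<U>)"
      using A by (auto simp: nonempty_closed_invariant_def closed_def)
    moreover have "act t x \<in> - \<Union>\<U>" if "x \<in> - \<Union>\<U>" for t x
      using A that by (fastforce simp: nonempty_closed_invariant_def)
    moreover have "- \<Union>\<U> \<subseteq> C"
      using A ne by blast
    ultimately show "\<Union>\<U> \<in> ?A"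
      by (simp add: nonempty_closed_invariant_def)
  qed auto
  then obtain U where U: "U \<in> ?A" and max: "\<forall>V\<in>?A. U \<subseteq> V \<longrightarrow> V = U"
    by (rule bexE)
  have "N = - U" if N: "N \<subseteq> - U" "nonempty_closed_invariant act N" for N
  proof -
    have "N \<subseteq> C"
      by (rule subset_trans[OF N(1)]) (use U in simp)
    then have "- N \<in> ?A"
      using N by simp
    moreover have "U \<subseteq> - N"
      using N(1) by blast
    ultimately show ?thesis
      using max by (metis double_compl)
  qed
  then have "minimal_set act X (- U)"
    using U subset_trans[OF _ assms(2), of "- U"] by (simp add: minimal_set_def)
  with U show ?thesis
    by (intro that[of "- U"]) simp_all
qed

lemma almost_periodic_exists:
  assumes "flow act X" "C \<subseteq> X" "nonempty_closed_invariant act C"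
  obtains p where "p \<in> C" "almost_periodic act X p"
proof -
  obtain M where M: "M \<subseteq> C" "minimal_set act X M"
    using minimal_set_exists[of X C act] assms by (auto simp: flow_def)
  then obtain p where p: "p \<in> M"
    by (auto simp: minimal_set_def nonempty_closed_invariant_def)
  then have pX: "p \<in> X"
    using M assms by blast
  have "orbit_closure act p = M"
    using M p orbit_closure_subset[of act M p]
      nonempty_closed_invariant_orbit_closure[OF assms(1) pX]
    by (simp add: minimal_set_def)
  then show ?thesis
    using M p assms by (intro that[of p]) (auto simp: almost_periodic_def)
qed

section \<open>Recognizability of Chacon blocks\<close>

text \<open>
  \<open>spacer n\<close> is the gap behind the \<open>n\<close>-th block in the decomposition of the one-sided limit of the
  \<open>B\<^sub>k\<close> into copies of \<open>B\<^sub>k\<close>; it does not depend on \<open>k\<close>, because the three copies of \<open>B\<^sub>k\<close> in \<open>B\<^sub>k\<^sub>+\<^sub>1\<close>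
  are followed by no spacer, a spacer, and whatever follows \<open>B\<^sub>k\<^sub>+\<^sub>1\<close>.
\<close>

fun spacer :: "nat \<Rightarrow> nat list" where
  "spacer n = (if n mod 3 = 0 then [] else if n mod 3 = 1 then [1] else spacer (n div 3))"

declare spacer.simps [simp del]

text \<open>The gap behind the last block is included, so that the blocks of level \<open>k\<close>
  in the decomposition begin exactly where some \<open>chacon_prefix k m\<close> ends.\<close>

primrec chacon_prefix :: "nat \<Rightarrow> nat \<Rightarrow> nat list" where
  "chacon_prefix k 0 = []"
| "chacon_prefix k (Suc n) = chacon_prefix k n @ chacon_block k @ spacer n"

lemma spacer_cases: "spacer n = [] \<or> spacer n = [1]"
proof (induction n rule: spacer.induct)
  case (1 n)
  then show ?case by (subst (1 2) spacer.simps) auto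
qed

lemma spacer_mult3:
  "spacer (3 * n) = []" "spacer (Suc (3 * n)) = [1]" "spacer (Suc (Suc (3 * n))) = spacer n"
proof -
  have "Suc (3 * n) mod 3 = 1" "Suc (Suc (3 * n)) mod 3 = 2" "Suc (Suc (3 * n)) div 3 = n"
    by presburger+
  then show "spacer (3 * n) = []" "spacer (Suc (3 * n)) = [1]"
    "spacer (Suc (Suc (3 * n))) = spacer n"
    by (simp_all add: spacer.simps[of "3 * n"] spacer.simps[of "Suc (3 * n)"]
        spacer.simps[of "Suc (Suc (3 * n))"])
qed

text \<open>An index of the form 3r+1 carries a spacer itself, and one of the form 3r+2 is followed
  by a multiple of 3, which has an empty gap. Hence this gap pattern marks the beginning of a block
  of the next level.\<close>

lemma spacer_empty_then_one:
  assumes "spacer n = []" "spacer (Suc n) = [1]"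
  obtains r where "n = 3 * r"
proof -
  have "n = 3 * (n div 3) \<or> n = Suc (3 * (n div 3)) \<or> Suc n = 3 * Suc (n div 3)"
    by presburger
  then show ?thesis
  proof (elim disjE)
    assume "n = 3 * (n div 3)"
    then show ?thesis by (rule that)
  next
    assume "n = Suc (3 * (n div 3))"
    then have "spacer n = [1]" using spacer_mult3(2) by metis
    with assms show ?thesis by simp
  next
    assume "Suc n = 3 * Suc (n div 3)"
    then have "spacer (Suc n) = []" using spacer_mult3(1) by metis
    with assms show ?thesis by simp
  qed
qed

lemma chacon_block_Cons: "\<exists>w. chacon_block k = 0 # w"
  by (induction k) auto

lemma length_chacon_block_gt: "k < length (chacon_block k)"
  by (induction k) auto

lemma chacon_block_nonempty [simp]: "chacon_block k \<noteq> []"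
  using chacon_block_Cons[of k] by auto

lemma chacon_prefix_Suc_left: "chacon_prefix (Suc k) n = chacon_prefix k (3 * n)"
proof (induction n)
  case (Suc n)
  have "3 * Suc n = Suc (Suc (Suc (3 * n)))"
    by simp
  with Suc show ?case
    by (simp only: chacon_prefix.simps chacon_block.simps spacer_mult3) simp
qed simp

lemma chacon_prefix_add: "chacon_prefix (k + m) n = chacon_prefix k (3 ^ m * n)"
  by (induction m arbitrary: n) (simp_all add: chacon_prefix_Suc_left mult_ac)

lemma chacon_prefix_append: "\<exists>w. chacon_prefix k (m + n) = chacon_prefix k m @ w"
  by (induction n) auto

lemma chacon_prefix_split:
  assumes "m < n"
  obtains w where "chacon_prefix k n = chacon_prefix k m @ chacon_block k @ spacer m @ w"
  using chacon_prefix_append[of k "Suc m" "n - Suc m"] assms by auto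

lemma length_chacon_prefix_le:
  assumes "m \<le> n"
  shows "length (chacon_prefix k m) \<le> length (chacon_prefix k n)"
  using chacon_prefix_append[of k m "n - m"] assms by auto

lemma chacon_block_append: "\<exists>w. chacon_block (k + m) = chacon_block k @ w"
  by (induction m) auto

lemma sublist_chacon_block_imp_prefix:
  assumes "sublist w (chacon_block K)"
  obtains n where "sublist w (chacon_prefix k n)"
proof -
  \<comment> \<open>These \<open>3 ^ K\<close> blocks form one block of level \<open>K + k\<close>;
    its gap \<open>spacer 0\<close> is empty. Passing to level \<open>K + k\<close> covers the case
    \<open>K < k\<close> as well.\<close>
  have "chacon_prefix k (3 ^ K) = chacon_block (K + k)"
    using chacon_prefix_add[of k K 1] spacer_mult3(1)[of 0] by (simp add: add.commute)
  moreover obtain v where "chacon_block (K + k) = chacon_block K @ v"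
    using chacon_block_append by blast
  ultimately have "sublist (chacon_block K) (chacon_prefix k (3 ^ K))"
    by simp
  then show ?thesis
    using assms that sublist_order.order_trans by blast
qed

text \<open>A copy of \<open>chacon_block (Suc k)\<close> contains copies of
  \<open>chacon_block k\<close>, which by induction are blocks of the decomposition. Between them
  stand an empty gap and then a spacer, and by \<open>spacer_empty_then_one\<close> this happens
  only where a block of level \<open>Suc k\<close> begins.\<close>

lemma chacon_prefix_recognizable:
  "chacon_prefix k n = u @ chacon_block k @ v \<Longrightarrow> \<exists>m<n. u = chacon_prefix k m"
proof (induction k arbitrary: n u v)
  case 0
  \<comment> \<open>At level 0 the blocks are exactly the letters 0. Stripping the last block and
    its gap from the right either meets the marked 0 or leaves a shorter prefix that contains
    it.\<close>
  then show ?case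
  proof (induction n arbitrary: v)
    case (Suc n)
    show ?case
    proof (cases v rule: rev_cases)
      case Nil
      then have "spacer n = []" "u = chacon_prefix 0 n"
        using Suc.prems spacer_cases[of n] by auto
      then show ?thesis by blast
    next
      case (snoc v' a)
      show ?thesis
      proof (cases "spacer n = []")
        case True
        then have "chacon_prefix 0 n = u @ chacon_block 0 @ v'"
          using Suc.prems snoc by simp
        then show ?thesis
          using Suc.IH less_Suc_eq by blast
      next
        case False
        then have *: "chacon_prefix 0 n @ [0] = u @ [0] @ v'"
          using Suc.prems snoc spacer_cases[of n] by auto
        show ?thesis
        proof (cases v' rule: rev_cases)
          case Nil
          then show ?thesis using * by auto
        next
          case (snoc v'' b)
          then have "chacon_prefix 0 n = u @ chacon_block 0 @ v''"
            using * by simp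
          then show ?thesis
            using Suc.IH less_Suc_eq by blast
        qed
      qed
    qed
  qed simp
next
  case (Suc k)
  let ?B = "chacon_block k" and ?P = "chacon_prefix k"
  have eq: "?P (3 * n) = u @ ?B @ ?B @ [1] @ ?B @ v"
    using Suc.prems by (simp add: chacon_prefix_Suc_left)
  obtain m where m: "m < 3 * n" "u = ?P m"
    using Suc.IH[of "3 * n" u "?B @ [1] @ ?B @ v"] eq by auto
  obtain m' where m': "m' < 3 * n" "u @ ?B = ?P m'"
    using Suc.IH[of "3 * n" "u @ ?B" "[1] @ ?B @ v"] eq by auto
  have h: "length ?B > 0"
    by simp
  have "\<not> m' \<le> m"
    using length_chacon_prefix_le[of m' m k] m m' h by (auto simp flip: m'(2))
  \<comment> \<open>The prefix of index \<open>m'\<close> is only one block longer than that of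
    index \<open>m\<close>, so there is no room for a spacer behind block \<open>m\<close>.\<close>
  then have "length (?P (Suc m)) \<le> length (?P m')"
    by (intro length_chacon_prefix_le) simp
  then have s0: "spacer m = []"
    using m by (simp flip: m'(2))
  then have m1: "u @ ?B = ?P (Suc m)"
    using m by simp
  have "Suc m < 3 * n"
  proof (rule ccontr)
    assume "\<not> Suc m < 3 * n"
    then have "3 * n = Suc m"
      using m(1) by simp
    then have "?P (3 * n) = u @ ?B"
      using m1 by (simp only:)
    then show False using eq by simp
  qed
  then obtain w where "?P (3 * n) = ?P (Suc m) @ ?B @ spacer (Suc m) @ w"
    by (rule chacon_prefix_split)
  then have w: "spacer (Suc m) @ w = [1] @ ?B @ v"
    using eq m s0 by simp
  \<comment> \<open>With an empty gap, either the prefix would end here, or the next block would put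
    a 0 where the copy has its spacer.\<close>
  have s1: "spacer (Suc m) = [1]"
  proof (rule ccontr)
    assume "spacer (Suc m) \<noteq> [1]"
    then have e: "spacer (Suc m) = []"
      using spacer_cases by blast
    have "Suc (Suc m) < 3 * n"
    proof (rule ccontr)
      assume "\<not> Suc (Suc m) < 3 * n"
      then have "3 * n = Suc (Suc m)"
        using \<open>Suc m < 3 * n\<close> by simp
      then have "?P (3 * n) = u @ ?B @ ?B"
        using e s0 m by simp
      then show False using eq by simp
    qed
    then obtain w' where "?P (3 * n) = ?P (Suc (Suc m)) @ ?B @ spacer (Suc (Suc m)) @ w'"
      by (rule chacon_prefix_split)
    then have "?B @ spacer (Suc (Suc m)) @ w' = [1] @ ?B @ v"
      using eq e s0 m by simp
    then show False
      using chacon_block_Cons[of k] by auto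
  qed
  obtain r where "m = 3 * r"
    using s0 s1 by (rule spacer_empty_then_one)
  then have "r < n" "u = chacon_prefix (Suc k) r"
    using m by (auto simp: chacon_prefix_Suc_left)
  then show ?case by blast
qed

section \<open>Blocks in points of the Chacon space\<close>

text \<open>Start and length replace the two end points of \<open>word\<close>, so that windows
  split by adding lengths.\<close>

definition window :: "(int \<Rightarrow> 'a) \<Rightarrow> int \<Rightarrow> nat \<Rightarrow> 'a list" where
  "window x p n = map (\<lambda>j. x (p + int j)) [0..<n]"

lemma length_window [simp]: "length (window x p n) = n"
  by (simp add: window_def)

lemma window_add: "window x p (m + n) = window x p m @ window x (p + int m) n"
  by (rule nth_equalityI) (auto simp: window_def nth_append)

lemma window_one [simp]: "window x p (Suc 0) = [x p]"
  by (simp add: window_def)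

lemma window_eq_iff: "window x p n = window y q n \<longleftrightarrow> (\<forall>j<n. x (p + int j) = y (q + int j))"
  by (auto simp: window_def)

lemma window_nth_eq:
  assumes "window x p n = window y p n" "p \<le> i" "i < p + int n"
  shows "x i = y i"
  using assms by (auto simp: window_eq_iff dest!: spec[of _ "nat (i - p)"])

lemma chacon_space_window:
  assumes "x \<in> chacon_space"
  obtains u v n where "chacon_prefix k n = u @ window x p l @ v"
proof -
  have "word x p (p + int n - 1) = window x p n" for n
    by (rule nth_equalityI) (auto simp: word_def window_def)
  \<comment> \<open>The space constrains words only for \<open>i < j\<close>; two extra letters
    ensure this even for \<open>l = 0\<close> and are cut off again.\<close>
  from this[of "l + 2"] have "word x p (p + int l + 1) = window x p (l + 2)"
    by (simp add: algebra_simps)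
  moreover have "\<exists>K. sublist (word x p (p + int l + 1)) (chacon_block K)"
    using assms by (simp add: chacon_space_def)
  ultimately obtain K where "sublist (window x p (l + 2)) (chacon_block K)"
    by auto
  then obtain n where "sublist (window x p (l + 2)) (chacon_prefix k n)"
    by (rule sublist_chacon_block_imp_prefix)
  then show ?thesis
    using that unfolding sublist_def window_add by (metis append.assoc)
qed

section \<open>Occurrences of blocks in a point\<close>

definition block_at :: "nat \<Rightarrow> (int \<Rightarrow> nat) \<Rightarrow> int \<Rightarrow> bool" where
  "block_at k x p \<longleftrightarrow> window x p (length (chacon_block k)) = chacon_block k"

lemma block_at_exists:
  assumes "x \<in> chacon_space"
  obtains p where "block_at k x p"
proof -
  let ?h = "length (chacon_block k)" and ?P = "chacon_prefix k"
  \<comment> \<open>A block with its gap has length at most \<open>?h + 1\<close>, so within that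
    distance of the window's left end a new block begins, and the rest of the window has room for
    all of it.\<close>
  obtain u v n where n: "?P n = u @ window x 0 (?h + 1 + ?h + 1) @ v"
    using chacon_space_window[OF assms] by blast
  define m where "m = (LEAST m. length u \<le> length (?P m))"
  have ex: "length u \<le> length (?P n)"
    using n by simp
  then have um: "length u \<le> length (?P m)" and "m \<le> n"
    unfolding m_def by (auto intro: LeastI Least_le)
  have le: "length (?P m) \<le> length u + ?h + 1"
  proof (cases m)
    case (Suc m')
    then have "\<not> length u \<le> length (?P m')"
      using not_less_Least[of m' "\<lambda>m. length u \<le> length (?P m)"] by (simp add: m_def)
    then show ?thesis
      using Suc spacer_cases[of m'] by auto
  qed simp
  have "m \<noteq> n"
    using le n by auto
  then have "m < n"
    using \<open>m \<le> n\<close> by simp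
  then obtain w where w: "?P n = ?P m @ chacon_block k @ spacer m @ w"
    by (rule chacon_prefix_split)
  define d where "d = length (?P m) - length u"
  have d: "length (?P m) = length u + d" "d \<le> ?h + 1"
    using um le by (auto simp: d_def)
  have "?h + 1 + ?h + 1 = d + (?h + (?h + 2 - d))"
    using d(2) by simp
  then have "window x 0 (?h + 1 + ?h + 1) =
      window x 0 d @ window x (int d) ?h @ window x (int d + int ?h) (?h + 2 - d)"
    by (simp only: window_add) simp
  then have "(u @ window x 0 d) @ window x (int d) ?h @ window x (int d + int ?h) (?h + 2 - d) @ v
      = ?P m @ chacon_block k @ spacer m @ w"
    using n w by simp
  then have "window x (int d) ?h = chacon_block k"
    using d by (subst (asm) append_eq_append_conv) auto
  then show ?thesis
    using that by (simp add: block_at_def)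
qed

text \<open>By recognizability the visible copy is a block of the decomposition, so behind it comes
  its gap and then the next block. The window has room for both.\<close>

lemma block_at_next:
  assumes "x \<in> chacon_space" "block_at k x p" "h = length (chacon_block k)"
  shows "block_at k x (p + int h) \<or> x (p + int h) = 1 \<and> block_at k x (p + int h + 1)"
proof -
  let ?P = "chacon_prefix k"
  obtain u v n where n: "?P n = u @ window x p (h + (1 + h)) @ v"
    using chacon_space_window[OF assms(1)] by blast
  then have eq: "?P n = u @ chacon_block k @ window x (p + int h) (1 + h) @ v"
    using assms(2,3) unfolding block_at_def window_add[of x p] by simp
  then obtain m where m: "m < n" "u = ?P m"
    using chacon_prefix_recognizable by blast
  have "0 < h"
    using assms(3) by simp
  \<comment> \<open>Otherwise the remaining \<open>1 + h\<close> letters of the window would have to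
    fit into one gap.\<close>
  have "Suc m \<noteq> n"
  proof
    assume "Suc m = n"
    then have "window x (p + int h) (1 + h) @ v = spacer m"
      using eq m by auto
    then have "1 + h \<le> length (spacer m)"
      by (metis length_append length_window le_add1)
    then show False
      using \<open>0 < h\<close> spacer_cases[of m] by auto
  qed
  then have "Suc m < n"
    using m by simp
  then obtain w where "?P n = ?P (Suc m) @ chacon_block k @ spacer (Suc m) @ w"
    by (rule chacon_prefix_split)
  then have w: "window x (p + int h) (1 + h) @ v
      = spacer m @ chacon_block k @ spacer (Suc m) @ w"
    using eq m by simp
  show ?thesis
    using spacer_cases[of m]
  proof
    assume "spacer m = []"
    then have "window x (p + int h) h @ window x (p + int h + int h) 1 @ v
        = chacon_block k @ spacer (Suc m) @ w"
      using w window_add[of x "p + int h" h 1] by (simp add: add.commute)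
    then show ?thesis
      using assms(3) by (simp add: block_at_def)
  next
    assume "spacer m = [1]"
    then have "[x (p + int h)] @ window x (p + int h + 1) h @ v
        = [1] @ chacon_block k @ spacer (Suc m) @ w"
      using w window_add[of x "p + int h" 1 h] by simp
    then show ?thesis
      using assms(3) by (simp add: block_at_def)
  qed
qed

lemma block_at_prev:
  assumes "x \<in> chacon_space" "block_at k x p" "h = length (chacon_block k)"
  shows "block_at k x (p - int h) \<or> x (p - 1) = 1 \<and> block_at k x (p - int h - 1)"
proof -
  let ?P = "chacon_prefix k"
  obtain u v n where n: "?P n = u @ window x (p - int h - 1) ((1 + h) + h) @ v"
    using chacon_space_window[OF assms(1)] by blast
  then have "?P n = (u @ window x (p - int h - 1) (1 + h)) @ chacon_block k @ v"
    using assms(2,3) unfolding block_at_def window_add[of x "p - int h - 1" "1 + h"] by simp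
  then obtain m where m: "u @ window x (p - int h - 1) (1 + h) = ?P m"
    using chacon_prefix_recognizable by blast
  \<comment> \<open>The left side is non-empty, so a block with its gap precedes the copy; it is
    compared with the window from the right end.\<close>
  then obtain m' where "m = Suc m'"
    by (cases m) (auto simp flip: length_0_conv)
  then have m': "u @ window x (p - int h - 1) (1 + h) = ?P m' @ chacon_block k @ spacer m'"
    using m by simp
  show ?thesis
    using spacer_cases[of m']
  proof
    assume "spacer m' = []"
    then have "(u @ window x (p - int h - 1) 1) @ window x (p - int h) h = ?P m' @ chacon_block k"
      using m' window_add[of x "p - int h - 1" 1 h] by simp
    then show ?thesis
      using assms(3) by (subst (asm) append_eq_append_conv) (auto simp: block_at_def)
  next
    assume "spacer m' = [1]"
    then have "(u @ window x (p - int h - 1) h) @ [x (p - 1)] = (?P m' @ chacon_block k) @ [1]"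
      using m' window_add[of x "p - int h - 1" h 1]
      by (simp add: add.commute)
    then have "u @ window x (p - int h - 1) h = ?P m' @ chacon_block k" "x (p - 1) = 1"
      by auto
    then show ?thesis
      using assms(3) by (subst (asm) append_eq_append_conv) (auto simp: block_at_def)
  qed
qed

section \<open>Walking from a common block to a disagreement\<close>

definition offset_blocks :: "nat \<Rightarrow> (int \<Rightarrow> nat) \<Rightarrow> (int \<Rightarrow> nat) \<Rightarrow> bool" where
  "offset_blocks k x y \<longleftrightarrow> (\<exists>p q. \<bar>q - p\<bar> = 1 \<and> block_at k x p \<and> block_at k y q)"

text \<open>As long as the gaps behind the common blocks agree, so do \<open>x\<close> and
  \<open>y\<close>, and the common position moves right without passing \<open>n\<close>. The walk
  is therefore finite and ends at two different gaps, one empty and one a spacer, behind which the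
  blocks start one place apart.\<close>

lemma offset_blocks_right:
  assumes "x \<in> chacon_space" "y \<in> chacon_space"
    and "block_at k x p" "block_at k y p" "p \<le> n" "x n \<noteq> y n"
  shows "offset_blocks k x y"
  using assms(3-5)
proof (induction "nat (n - p)" arbitrary: p rule: less_induct)
  case less
  define h where "h = length (chacon_block k)"
  have "0 < h"
    by (simp add: h_def)
  have "window x p h = window y p h"
    using less.prems by (simp add: block_at_def h_def)
  then have n: "p + int h \<le> n"
    using window_nth_eq[of x p h y n] less.prems assms(6) by fastforce
  from block_at_next[OF assms(1) less.prems(1) h_def]
  show ?case
  proof
    assume x: "block_at k x (p + int h)"
    from block_at_next[OF assms(2) less.prems(2) h_def]
    show ?thesis
    proof
      assume "block_at k y (p + int h)"
      then show ?thesis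
        using x n \<open>0 < h\<close> by (intro less.hyps[of "p + int h"]) auto
    next
      assume "y (p + int h) = 1 \<and> block_at k y (p + int h + 1)"
      then show ?thesis
        using x unfolding offset_blocks_def
        by (intro exI[of _ "p + int h"] exI[of _ "p + int h + 1"]) auto
    qed
  next
    assume x: "x (p + int h) = 1 \<and> block_at k x (p + int h + 1)"
    from block_at_next[OF assms(2) less.prems(2) h_def]
    show ?thesis
    proof
      assume "block_at k y (p + int h)"
      then show ?thesis
        using x unfolding offset_blocks_def
        by (intro exI[of _ "p + int h + 1"] exI[of _ "p + int h"]) auto
    next
      assume y: "y (p + int h) = 1 \<and> block_at k y (p + int h + 1)"
      then have "n \<noteq> p + int h"
        using x assms(6) by auto
      then show ?thesis
        using x y n by (intro less.hyps[of "p + int h + 1"]) auto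
    qed
  qed
qed

text \<open>The walk runs leftwards here. As \<open>p\<close> is the left end of a block, it is the
  block just reached that has to be excluded as the place of \<open>n\<close>; \<open>agree\<close>
  does this.\<close>

lemma offset_blocks_left:
  assumes "x \<in> chacon_space" "y \<in> chacon_space"
    and "block_at k x p" "block_at k y p" "n < p" "x n \<noteq> y n"
  shows "offset_blocks k x y"
  using assms(3-5)
proof (induction "nat (p - n)" arbitrary: p rule: less_induct)
  case less
  define h where "h = length (chacon_block k)"
  have "0 < h"
    by (simp add: h_def)
  have agree: "n < q" if "block_at k x q" "block_at k y q" "n < q + int h" for q
  proof -
    have "window x q h = window y q h"
      using that by (simp add: block_at_def h_def)
    then show ?thesis
      using window_nth_eq[of x q h y n] that assms(6) by fastforce
  qed
  from block_at_prev[OF assms(1) less.prems(1) h_def]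
  show ?case
  proof
    assume x: "block_at k x (p - int h)"
    from block_at_prev[OF assms(2) less.prems(2) h_def]
    show ?thesis
    proof
      assume y: "block_at k y (p - int h)"
      then have "n < p - int h"
        using x agree less.prems by simp
      then show ?thesis
        using x y \<open>0 < h\<close> by (intro less.hyps[of "p - int h"]) auto
    next
      assume "y (p - 1) = 1 \<and> block_at k y (p - int h - 1)"
      then show ?thesis
        using x unfolding offset_blocks_def
        by (intro exI[of _ "p - int h"] exI[of _ "p - int h - 1"]) auto
    qed
  next
    assume x: "x (p - 1) = 1 \<and> block_at k x (p - int h - 1)"
    from block_at_prev[OF assms(2) less.prems(2) h_def]
    show ?thesis
    proof
      assume "block_at k y (p - int h)"
      then show ?thesis
        using x unfolding offset_blocks_def
        by (intro exI[of _ "p - int h - 1"] exI[of _ "p - int h"]) auto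
    next
      assume y: "y (p - 1) = 1 \<and> block_at k y (p - int h - 1)"
      then have "n \<noteq> p - 1"
        using x assms(6) by auto
      then have "n < p - int h - 1"
        using x y agree[of "p - int h - 1"] less.prems by simp
      then show ?thesis
        using x y by (intro less.hyps[of "p - int h - 1"]) auto
    qed
  qed
qed

text \<open>Every point contains the block 0010. The consequence used later is that the shift has no
  fixed point in the space.\<close>

lemma chacon_space_not_constant:
  assumes "x \<in> chacon_space"
  obtains n where "x (n + 1) \<noteq> x n"
proof -
  obtain p where "block_at 1 x p"
    using block_at_exists[OF assms] .
  then have "x (p + 1) = 0" "x (p + 2) = 1"
    by (simp_all add: block_at_def window_def upt_rec)
  then show ?thesis
    using that[of "p + 1"] by (simp add: add.assoc)
qed

section \<open>Pairs of points\<close>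

abbreviation chacon_pair_closure ::
  "(int \<Rightarrow> nat) \<Rightarrow> (int \<Rightarrow> nat) \<Rightarrow> ((int \<Rightarrow> nat) \<times> (int \<Rightarrow> nat)) set" where
  "chacon_pair_closure x y \<equiv> orbit_closure (diag_act chacon_action) (x, y)"

lemma diag_act_chacon: "diag_act chacon_action t (x, y) = (\<lambda>n. x (n + t), \<lambda>n. y (n + t))"
  by (simp add: diag_act_def chacon_action_def int_action_shift)

lemma closed_coordinates_eq: "closed {p :: (int \<Rightarrow> nat) \<times> (int \<Rightarrow> nat). snd p i = fst p j}"
  by (rule closed_Collect_eq;
      rule continuous_on_product_then_coordinatewise, intro continuous_intros)

text \<open>The pairs whose coordinates both agree with \<open>z\<close> on the block form an open
  neighbourhood of \<open>(z, z)\<close>, which the orbit of \<open>(x, y)\<close> must enter at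
  some time \<open>t\<close>; the common block then sits at \<open>p + t\<close>.\<close>

lemma diagonal_in_closure_imp_common_block:
  assumes "(z, z) \<in> chacon_pair_closure x y" "block_at k z p"
  obtains q where "block_at k x q" "block_at k y q"
proof -
  let ?h = "length (chacon_block k)"
  let ?U = "\<Inter>i\<in>{p..<p + int ?h}. {q :: (int \<Rightarrow> nat) \<times> (int \<Rightarrow> nat). fst q i = z i \<and> snd q i = z i}"
  have "open {q :: (int \<Rightarrow> nat) \<times> (int \<Rightarrow> nat). fst q i = z i \<and> snd q i = z i}" for i
  proof -
    let ?V = "{w :: int \<Rightarrow> nat. w i \<in> {z i}}"
    have "open ?V"
      by (rule open_coordinate_preimage[OF open_discrete])
    then have "open (?V \<times> ?V)"
      by (intro open_Times)
    moreover have "?V \<times> ?V = {q. fst q i = z i \<and> snd q i = z i}"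
      by auto
    ultimately show ?thesis by simp
  qed
  then have "open ?U"
    by (intro open_INT) auto
  moreover have "(z, z) \<in> ?U"
    by simp
  ultimately have "?U \<inter> range (\<lambda>t. diag_act chacon_action t (x, y)) \<noteq> {}"
    using assms(1) open_Int_closure_eq_empty[of ?U] unfolding orbit_closure_def by blast
  then obtain t where t: "\<And>i. p \<le> i \<Longrightarrow> i < p + int ?h \<Longrightarrow> x (i + t) = z i \<and> y (i + t) = z i"
    by (fastforce simp: diag_act_chacon)
  have "window x (p + t) ?h = window z p ?h" "window y (p + t) ?h = window z p ?h"
    using t[of "p + int j" for j] by (simp_all add: window_eq_iff algebra_simps)
  then show ?thesis
    using assms(2) that by (simp add: block_at_def)
qed

lemma offset_blocks_imp_almost_periodic:
  assumes "x \<in> chacon_space" "y \<in> chacon_space" "\<And>k. offset_blocks k x y"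
  obtains p where "p \<in> chacon_pair_closure x y" "p \<in> Omega chacon_action chacon_space"
    "p \<notin> Id_on chacon_space"
proof -
  let ?C = "chacon_pair_closure x y" and ?XX = "chacon_space \<times> chacon_space"
  note fl = flow_diag_act[OF chacon_flow]
  have xy: "(x, y) \<in> ?XX"
    using assms by simp
  have inv: "nonempty_closed_invariant (diag_act chacon_action) ?C"
    using fl xy by (rule nonempty_closed_invariant_orbit_closure)
  have sub: "?C \<subseteq> ?XX"
    using fl xy by (rule orbit_closure_subset_space)
  have comp: "compact ?C"
    using inv sub fl closed_Int_compact[of ?C ?XX]
    by (simp add: nonempty_closed_invariant_def flow_def Int_absorb2)
  \<comment> \<open>\<open>F e N\<close> approximates, on the coordinates from \<open>-N\<close> to
    \<open>N\<close>, the condition that the second sequence is the first one moved by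
    \<open>e\<close>.\<close>
  define F where "F e N = {p \<in> ?C. \<forall>j\<in>{- int N..int N}. snd p (j + e) = fst p j}" for e N
  have F_mono: "F e N \<subseteq> F e M" if "M \<le> N" for e M N
    using that by (auto simp: F_def)
  have F_ne: "F 1 N \<noteq> {} \<or> F (- 1) N \<noteq> {}" for N
  proof -
    \<comment> \<open>A block of level \<open>2 * N\<close> has more than \<open>2 * N\<close>
      letters. Moving the place \<open>p + N\<close> to the origin thus leaves \<open>N\<close>
      matching letters on either side.\<close>
    let ?h = "length (chacon_block (2 * N))"
    obtain p q where pq: "\<bar>q - p\<bar> = 1" "block_at (2 * N) x p" "block_at (2 * N) y q"
      using assms(3) unfolding offset_blocks_def by blast
    have "window x p ?h = window y q ?h"
      using pq by (simp add: block_at_def)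
    then have eq: "x (p + int j) = y (q + int j)" if "j \<le> 2 * N" for j
      using that length_chacon_block_gt[of "2 * N"] by (simp add: window_eq_iff)
    have "y (j + (q - p) + (p + int N)) = x (j + (p + int N))" if "- int N \<le> j" "j \<le> int N" for j
      using eq[of "nat (j + int N)"] that by (simp add: algebra_simps)
    moreover have "diag_act chacon_action (p + int N) (x, y) \<in> ?C"
      using inv mem_orbit_closure[OF fl xy] by (simp add: nonempty_closed_invariant_def)
    ultimately have "F (q - p) N \<noteq> {}"
      by (auto simp: F_def diag_act_chacon intro!: exI)
    moreover have "q - p = 1 \<or> q - p = - 1"
      using pq(1) by linarith
    ultimately show ?thesis by auto
  qed
  \<comment> \<open>The sign in \<open>F_ne\<close> may depend on \<open>N\<close>. But if
    \<open>F 1 M\<close> is empty, so is every later \<open>F 1 N\<close>; then the sign -1 works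
    for all large \<open>N\<close>, and by monotonicity for all \<open>N\<close>.\<close>
  obtain e where e: "e = 1 \<or> e = - 1" "\<And>N. F e N \<noteq> {}"
  proof (cases "\<forall>N. F 1 N \<noteq> {}")
    case False
    then obtain M where "F 1 M = {}"
      by blast
    then have "F (- 1) N \<noteq> {}" for N
      using F_ne[of "max M N"] F_mono[of M "max M N" 1] F_mono[of N "max M N" "- 1"] by auto
    then show ?thesis
      using that[of "- 1"] by simp
  qed (use that[of 1] in simp)
  define E where "E = {p \<in> ?C. \<forall>j. snd p (j + e) = fst p j}"
  have "?C \<inter> (\<Inter>N\<in>UNIV. F e N) \<noteq> {}"
  proof (rule compact_imp_fip_image[OF comp])
    have "F e N = ?C \<inter> (\<Inter>j\<in>{- int N..int N}. {p. snd p (j + e) = fst p j})" for N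
      by (auto simp: F_def)
    moreover have "closed ?C"
      using inv by (simp add: nonempty_closed_invariant_def)
    ultimately show "closed (F e N)" for N
      by (simp add: closed_Int closed_INT closed_coordinates_eq)
    fix I :: "nat set" assume "finite I"
    \<comment> \<open>Inserting 0 keeps the maximum meaningful when \<open>I\<close> is
      empty.\<close>
    then have "F e (Max (insert 0 I)) \<subseteq> (\<Inter>N\<in>I. F e N)"
      by (intro INT_greatest F_mono) simp
    moreover have "F e (Max (insert 0 I)) \<subseteq> ?C"
      by (auto simp: F_def)
    ultimately show "?C \<inter> (\<Inter>N\<in>I. F e N) \<noteq> {}"
      using e(2)[of "Max (insert 0 I)"] by blast
  qed
  then obtain p where p: "p \<in> ?C" "\<And>N. p \<in> F e N"
    by blast
  have "snd p (j + e) = fst p j" for j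
    using p(2)[of "nat \<bar>j\<bar>"] unfolding F_def by (simp add: Ball_def) (smt (verit))
  then have "E \<noteq> {}"
    using p(1) unfolding E_def by blast
  moreover have "closed E"
  proof -
    have "E = ?C \<inter> (\<Inter>j. {p. snd p (j + e) = fst p j})"
      by (auto simp: E_def)
    then show ?thesis
      using inv by (auto simp: nonempty_closed_invariant_def intro!: closed_coordinates_eq)
  qed
  moreover have "diag_act chacon_action t p \<in> E" if "p \<in> E" for t p
  proof -
    obtain u v where p: "p = (u, v)" by fastforce
    have "v (n + e + t) = u (n + t)" for n
      using that by (simp add: E_def p add.assoc add.commute[of e])
        (simp flip: add.assoc)
    moreover have "diag_act chacon_action t p \<in> ?C"
      using that inv by (simp add: E_def nonempty_closed_invariant_def)
    ultimately show ?thesis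
      by (simp add: E_def p diag_act_chacon)
  qed
  ultimately have "nonempty_closed_invariant (diag_act chacon_action) E"
    by (simp add: nonempty_closed_invariant_def)
  moreover have "E \<subseteq> ?XX"
    using sub by (auto simp: E_def)
  ultimately obtain p where p: "p \<in> E" "almost_periodic (diag_act chacon_action) ?XX p"
    using almost_periodic_exists[OF fl] by blast
  have "p \<notin> Id_on chacon_space"
  proof
    assume "p \<in> Id_on chacon_space"
    then obtain z where z: "p = (z, z)" "z \<in> chacon_space"
      by auto
    obtain n where "z (n + 1) \<noteq> z n"
      using chacon_space_not_constant[OF z(2)] .
    moreover have "z (j + e) = z j" for j
      using p(1) z by (simp add: E_def)
    \<comment> \<open>The first instance settles \<open>e = 1\<close>, the second
      \<open>e = -1\<close>.\<close>
    from this[of n] this[of "n + 1"] have "z (n + 1) = z n"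
      using e(1) by auto
    ultimately show False by simp
  qed
  then show ?thesis
    using p by (intro that[of p]) (simp_all add: E_def Omega_def)
qed

theorem mainTheorem2:
  shows "weakly_distal chacon_action chacon_space"
  unfolding weakly_distal_def
proof (intro conjI subset_antisym subsetI)
  show "flow chacon_action chacon_space"
    by (rule chacon_flow)
next
  let ?A = "diag_act chacon_action" and ?XX = "chacon_space \<times> chacon_space"
  note fl = flow_diag_act[OF chacon_flow]
  fix p assume p: "p \<in> SP chacon_action chacon_space"
  obtain x y where xy: "p = (x, y)" "x \<in> chacon_space" "y \<in> chacon_space"
    using p by (auto simp: SP_def)
  then have pX: "(x, y) \<in> ?XX"
    by simp
  have sp: "chacon_pair_closure x y \<inter> Omega chacon_action chacon_space \<subseteq> Id_on chacon_space"
    using p xy by (simp add: SP_def)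
  obtain w where "w \<in> chacon_pair_closure x y" "almost_periodic ?A ?XX w"
    using almost_periodic_exists[OF fl orbit_closure_subset_space[OF fl pX]
        nonempty_closed_invariant_orbit_closure[OF fl pX]] .
  moreover from this obtain z where "w = (z, z)" "z \<in> chacon_space"
    using sp by (auto simp: Omega_def)
  ultimately have z: "(z, z) \<in> chacon_pair_closure x y" "z \<in> chacon_space"
    by simp_all
  show "p \<in> Id_on chacon_space"
  proof (cases "x = y")
    case False
    then obtain n where n: "x n \<noteq> y n"
      by blast
    have "offset_blocks k x y" for k
    proof -
      obtain r where "block_at k z r"
        using block_at_exists[OF z(2)] .
      then obtain q where q: "block_at k x q" "block_at k y q"
        using diagonal_in_closure_imp_common_block[OF z(1)] by blast
      show ?thesis
        \<comment> \<open>The disagreement \<open>n\<close> lies either at or to the right of the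
          common position \<open>q\<close>, or to its left.\<close>
        using offset_blocks_right[OF xy(2,3) q _ n] offset_blocks_left[OF xy(2,3) q _ n]
        by linarith
    qed
    then show ?thesis
      using offset_blocks_imp_almost_periodic[OF xy(2,3)] sp by blast
  qed (use xy in auto)
next
  note fl = flow_diag_act[OF chacon_flow]
  fix p assume "p \<in> Id_on chacon_space"
  then obtain x where x: "p = (x, x)" "x \<in> chacon_space"
    by auto
  \<comment> \<open>For the converse inclusion: the diagonal is closed and invariant, so the orbit
    closure of a diagonal pair never leaves it.\<close>
  have "chacon_pair_closure x x \<subseteq> {p. fst p = snd p}"
    unfolding orbit_closure_def
    by (intro closure_minimal closed_Collect_eq continuous_intros) (auto simp: diag_act_chacon)
  moreover have "chacon_pair_closure x x \<subseteq> chacon_space \<times> chacon_space"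
    using fl x by (intro orbit_closure_subset_space) auto
  ultimately show "p \<in> SP chacon_action chacon_space"
    using x by (fastforce simp: SP_def)
qed

end
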